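(* $$\sum_{n=1}^{\infty}\frac{C_n\left(H_{2n}-\frac{1}{2}H_n\right)}{4^n(2n+1)}\left(\frac{\pi}{2}-\frac{(2n)!!}{(2n+1)!!}\right)=2\ln 2+\frac{7}{8}\zeta(3)+\frac{\pi}{12}\bigl(-12+\pi(-1+\ln 8)\bigr).$$
   Context: $H_n=\sum_{k=1}^n \frac1k$ is the $n$-th harmonic number. $C_n=\frac{1}{n+1}\binom{2n}{n}$ is the $n$-th Catalan number. The double factorial is $n!!=\prod_{k=0}^{\lceil n/2\rceil-1}(n-2k)$, i.e. $n!!=\prod_{k=1}^{n/2}(2k)$ for $n$ even and $n!!=\prod_{k=1}^{(n+1)/2}(2k-1)$ for $n$ odd. $\zeta$ is the Riemann zeta function, so $\zeta(3)=\sum_{n\ge1}n^{-3}$. *)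

theory Defs
  imports "HOL-Analysis.Analysis"
begin

(* Real-valued quotient: no natural-number division is involved. *)
definition catalan :: "nat \<Rightarrow> real" where
  "catalan n = real ((2 * n) choose n) / real (n + 1)"

(* The ceiling of n/2 is (n + 1) div 2. Each index k below it satisfies 2 * k < n,
   so the subtraction on nat never truncates. *)
definition double_fact :: "nat \<Rightarrow> nat" where
  "double_fact n = (\<Prod>k<(n + 1) div 2. n - 2 * k)"

lemma double_fact_even: "double_fact (2 * m) = (\<Prod>k=1..m. 2 * k)"
proof -
  have "double_fact (2 * m) = (\<Prod>k<m. 2 * (m - k))"
    by (simp add: double_fact_def diff_mult_distrib2)
  also have "\<dots> = (\<Prod>k=1..m. 2 * k)"
    by (rule prod.reindex_bij_witness[of _ "\<lambda>k. m - k" "\<lambda>k. m - k"]) auto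
  finally show ?thesis .
qed

lemma double_fact_odd: "double_fact (2 * m + 1) = (\<Prod>k=1..m + 1. 2 * k - 1)"
proof -
  have "double_fact (2 * m + 1) = (\<Prod>k<m + 1. 2 * m + 1 - 2 * k)"
    by (simp add: double_fact_def)
  also have "\<dots> = (\<Prod>k=1..m + 1. 2 * k - 1)"
    by (rule prod.reindex_bij_witness[of _ "\<lambda>k. m + 1 - k" "\<lambda>k. m + 1 - k"]) auto
  finally show ?thesis .
qed

(* The Riemann zeta function on the real half-line s > 1, where it is given by its Dirichlet
   series; for s \<le> 1 the series diverges and the value is not meaningful. *)
definition zeta :: "real \<Rightarrow> real" where
  "zeta s = (\<Sum>n. 1 / real (Suc n) powr s)"

end

theory Submission
  imports Defs "HOL-Real_Asymp.Real_Asymp"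
begin

text \<open>Write \<open>O\<^sub>n = 1 + 1/3 + \<dots> + 1/(2 n - 1)\<close>, which equals \<open>H\<^sub>2\<^sub>n - H\<^sub>n / 2\<close>, and
  \<open>b\<^sub>n = (2n choose n) / 4 ^ n\<close>.  The ratio of double factorials times \<open>b\<^sub>n\<close> is \<open>1 / (2 n + 1)\<close>, so
  the \<open>n\<close>-th term is
  \<open>\<pi>/2 * b\<^sub>n O\<^sub>n / ((n + 1) (2 n + 1)) - O\<^sub>n / ((n + 1) (2 n + 1)\<^sup>2)\<close>.  Partial fractions reduce
  the series to four sums:

  \<^item> \<open>\<Sum> b\<^sub>n O\<^sub>n / (2 n + 1) = \<pi>/2 * ln 2\<close> (\<open>sums_cbin_odd_harm_over_odd\<close>),
  \<^item> \<open>\<Sum> b\<^sub>n O\<^sub>n / (2 n + 2) = 1\<close> (\<open>sums_cbin_odd_harm_over_even\<close>),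
  \<^item> \<open>\<Sum> O\<^sub>n / ((n + 1) (2 n + 1)) = 2 ln 2 - \<pi>\<^sup>2/12\<close> (\<open>sums_odd_harm_over_pair\<close>),
  \<^item> \<open>\<Sum> O\<^sub>n / (2 n + 1)\<^sup>2 = \<pi>\<^sup>2/8 * ln 2 - 7/16 * \<zeta>(3)\<close> (\<open>sums_odd_harm_over_odd_square\<close>).

  Integral representations would evaluate each of them, but the route taken here stays discrete.  Each
  sum is the total of an infinite array of nonnegative numbers, and is found by summing the array in
  another order: by rows, by columns or along the diagonals \<open>i + j = n\<close>.  Rows and columns reduce to
  telescoping series.  Diagonals are finite sums, with closed forms either by
  \<open>1 / (x y) = (1/x + 1/y) / (x + y)\<close> or because they are coefficients of products of power series such
  as \<open>sqrt (1 - y)\<close>, \<open>1 / sqrt (1 - y)\<close> and \<open>ln (1 - y)\<close>.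

  The constants enter from outside in three places: \<open>ln 2\<close> through the alternating harmonic series,
  \<open>\<pi>\<^sup>2\<close> through \<open>\<zeta>(2)\<close>, and the value \<open>\<pi>/2\<close> of \<open>\<Sum> b\<^sub>n / (2 n + 1)\<close> through Wallis' product.\<close>

section \<open>Double series of nonnegative terms\<close>

text \<open>For nonnegative entries, convergence of the iterated sum by rows already is absolute convergence
  of the double series, so every other order of summation has the same total.\<close>

lemma has_sum_of_rows:
  fixes f :: "nat \<Rightarrow> nat \<Rightarrow> real"
  assumes nonneg: "\<And>i j. 0 \<le> f i j"
    and rows: "\<And>i. f i sums R i" and total: "R sums S"
  shows "((\<lambda>(i, j). f i j) has_sum S) (UNIV \<times> UNIV)"
proof -
  have row: "(f i has_sum R i) UNIV" for i
    by (rule sums_nonneg_imp_has_sum[OF rows]) (rule nonneg)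
  have "0 \<le> R i" for i
    using row[of i] nonneg by (meson has_sum_nonneg)
  then have R: "(R has_sum S) UNIV"
    by (intro sums_nonneg_imp_has_sum total)
  have "(\<lambda>(i, j). f i j) summable_on (UNIV \<times> UNIV)"
    by (rule summable_on_SigmaI[where g = R]) (use row R nonneg in \<open>auto simp: summable_on_def\<close>)
  then show ?thesis
    by (intro has_sum_SigmaI[where g = R]) (use row R in auto)
qed

lemma sums_columns:
  fixes f :: "nat \<Rightarrow> nat \<Rightarrow> real"
  assumes "\<And>i j. 0 \<le> f i j" and "\<And>i. f i sums R i" and "R sums S"
    and cols: "\<And>j. (\<lambda>i. f i j) sums C j"
  shows "C sums S"
proof -
  have "((\<lambda>(j, i). f i j) has_sum S) (UNIV \<times> UNIV)"
    using has_sum_of_rows[OF assms(1-3)] has_sum_swap[of "\<lambda>(i, j). f i j" UNIV UNIV S] by simp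
  then have "(C has_sum S) UNIV"
    by (rule has_sum_SigmaD) (use sums_nonneg_imp_has_sum[OF cols assms(1)] in auto)
  then show ?thesis
    by (rule has_sum_imp_sums)
qed

lemma sums_diagonals:
  fixes f :: "nat \<Rightarrow> nat \<Rightarrow> real"
  assumes "\<And>i j. 0 \<le> f i j" and "\<And>i. f i sums R i" and "R sums S"
  shows "(\<lambda>n. \<Sum>i\<le>n. f i (n - i)) sums S"
proof -
  have "((\<lambda>(n, i). f i (n - i)) has_sum S) (SIGMA n:UNIV. {..n}) \<longleftrightarrow>
        ((\<lambda>(i, j). f i j) has_sum S) (UNIV \<times> UNIV)"
    by (rule has_sum_reindex_bij_witness[of _ "\<lambda>(i, j). (i + j, i)" "\<lambda>(n, i). (i, n - i)"]) auto
  then have "((\<lambda>(n, i). f i (n - i)) has_sum S) (SIGMA n:UNIV. {..n})"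
    using has_sum_of_rows[OF assms] by simp
  then have "((\<lambda>n. \<Sum>i\<le>n. f i (n - i)) has_sum S) UNIV"
    by (rule has_sum_SigmaD) (auto intro: has_sum_finiteI)
  then show ?thesis
    by (rule has_sum_imp_sums)
qed

text \<open>Splitting off the even indices, which carry the fraction \<open>1 / 2 ^ p\<close> of the whole sum.\<close>

lemma odd_power_sums:
  fixes Z :: real
  assumes "(\<lambda>n. 1 / (real n + 1) ^ p) sums Z"
  shows "(\<lambda>n. 1 / (2 * real n + 1) ^ p) sums ((1 - 1 / 2 ^ p) * Z)"
proof -
  have "(\<lambda>n. \<Sum>k = n * 2..<n * 2 + 2. 1 / (real k + 1) ^ p) sums Z"
    by (rule sums_group[OF assms]) simp
  moreover have "(\<Sum>k = n * 2..<n * 2 + 2. 1 / (real k + 1) ^ p)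
      = 1 / (2 * real n + 1) ^ p + 1 / 2 ^ p * (1 / (real n + 1) ^ p)" for n
  proof -
    have "(2 * real n + 2) ^ p = 2 ^ p * (real n + 1) ^ p"
      by (simp flip: power_mult_distrib add: algebra_simps)
    then show ?thesis
      by (simp add: numeral_2_eq_2 add_ac mult.commute)
  qed
  ultimately have "(\<lambda>n. 1 / (2 * real n + 1) ^ p + 1 / 2 ^ p * (1 / (real n + 1) ^ p)) sums Z"
    by simp
  from sums_diff[OF this sums_mult[OF assms, of "1 / 2 ^ p"]] show ?thesis
    by (simp add: algebra_simps)
qed

section \<open>Odd harmonic numbers\<close>

definition odd_harm :: "nat \<Rightarrow> real" where
  "odd_harm n = (\<Sum>k<n. 1 / (2 * real k + 1))"

lemma odd_harm_0 [simp]: "odd_harm 0 = 0"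
  by (simp add: odd_harm_def)

lemma odd_harm_Suc [simp]: "odd_harm (Suc n) = odd_harm n + 1 / (2 * real n + 1)"
  by (simp add: odd_harm_def)

lemma odd_harm_nonneg: "0 \<le> odd_harm n"
  by (simp add: odd_harm_def sum_nonneg)

lemma half_harm_Suc: "harm (Suc n) / 2 = harm n / 2 + 1 / (2 * real n + 2)"
proof -
  have "1 / (2 * real n + 2) = inverse (real (Suc n)) / 2"
    by (simp add: field_simps)
  then show ?thesis
    by (simp add: harm_Suc add_divide_distrib)
qed

lemma odd_harm_eq_harm: "odd_harm n = harm (2 * n) - 1 / 2 * harm n"
proof (induction n)
  case (Suc n)
  have "harm (2 * Suc n) = harm (2 * n) + 1 / (2 * real n + 1) + 1 / (2 * real n + 2)"
    by (simp add: harm_Suc inverse_eq_divide add_ac)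
  then show ?case
    using Suc half_harm_Suc[of n] unfolding odd_harm_Suc by linarith
qed (simp add: harm_expand(1))

text \<open>The series with \<open>harm n\<close> below are compared with those of \<open>odd_harm n\<close> for convergence.\<close>

lemma harm_le_odd_harm: "harm n / 2 \<le> odd_harm n"
proof (induction n)
  case (Suc n)
  have "1 / (2 * real n + 2) \<le> 1 / (2 * real n + 1)"
    by (simp add: field_simps)
  then show ?case
    using Suc half_harm_Suc[of n] by simp
qed (simp add: harm_expand(1))

text \<open>Summation by parts without boundary terms: both sides sum the nonnegative array
  \<open>g (k + m) / (2 k + 1)\<close>.\<close>

lemma sums_odd_harm_by_parts:
  assumes "\<And>n. 0 \<le> g n" and "\<And>k. (\<lambda>m. g (k + m)) sums T k"
    and "(\<lambda>k. T k / (2 * real k + 1)) sums S"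
  shows "(\<lambda>n. odd_harm (Suc n) * g n) sums S"
proof -
  have "(\<lambda>n. \<Sum>k\<le>n. g (k + (n - k)) / (2 * real k + 1)) sums S"
    by (rule sums_diagonals[where f = "\<lambda>k m. g (k + m) / (2 * real k + 1)"])
      (use assms in \<open>auto intro: sums_divide\<close>)
  then show ?thesis
    by (simp add: odd_harm_def sum_distrib_right lessThan_Suc_atMost del: odd_harm_Suc)
qed

lemma telescope_inverse:
  fixes a d :: real
  assumes "0 < a" and "0 < d"
  shows "(\<lambda>n. 1 / (d * real n + a) - 1 / (d * real n + a + d)) sums (1 / a)"
proof -
  have "(\<lambda>n. 1 / (d * real n + a)) \<longlonglongrightarrow> 0"
    using assms by real_asymp
  from telescope_sums'[OF this] show ?thesis
    by (simp add: algebra_simps)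
qed

lemma alternating_harmonic_pairs: "(\<lambda>n. 1 / (2 * real n + 1) - 1 / (2 * real n + 2)) sums ln 2"
  using alternating_harmonic_series_sums' by (simp add: inverse_eq_divide add_ac)

lemma sums_odd_minus_odd:
  "(\<lambda>n. 1 / (2 * real n + 1) - 1 / (2 * real n + 1 + 2 * real p)) sums odd_harm p"
proof (induction p)
  case (Suc p)
  from sums_add[OF Suc telescope_inverse[of "2 * real p + 1" 2]] show ?case
    by (simp add: algebra_simps)
qed simp

lemma sums_even_minus_even:
  "(\<lambda>n. 1 / (2 * real n + 2) - 1 / (2 * real n + 2 + 2 * real p)) sums (harm p / 2)"
proof (induction p)
  case 0
  show ?case by (simp add: harm_expand(1))
next
  case (Suc p)
  from sums_add[OF Suc telescope_inverse[of "2 * real p + 2" 2]] show ?case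
    by (simp add: half_harm_Suc algebra_simps)
qed

lemma sums_odd_minus_even:
  "(\<lambda>n. 1 / (2 * real n + 1) - 1 / (2 * real n + 2 + 2 * real p)) sums (ln 2 + harm p / 2)"
  using sums_add[OF alternating_harmonic_pairs sums_even_minus_even[of p]] by simp

lemma sums_even_minus_odd:
  "(\<lambda>n. 1 / (2 * real n + 2) - 1 / (2 * real n + 1 + 2 * real p)) sums (odd_harm p - ln 2)"
  using sums_diff[OF sums_odd_minus_odd[of p] alternating_harmonic_pairs] by simp

lemma inverse_product_eq:
  fixes x y d :: real
  assumes "y = x + d" and "0 < x" and "0 < d"
  shows "1 / (x * y) = (1 / x - 1 / y) / d"
proof -
  have "1 / x - 1 / y = d / (x * y)"
    using assms by (simp add: diff_frac_eq)
  then show ?thesis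
    using assms by simp
qed

lemma sums_inverse_odd_odd:
  "(\<lambda>i. 1 / ((2 * real i + 1) * (2 * real i + 1 + 2 * (real j + 1))))
     sums (odd_harm (Suc j) / (2 * real j + 2))"
proof -
  have "(\<lambda>i. (1 / (2 * real i + 1) - 1 / (2 * real i + 1 + 2 * real (Suc j))) / (2 * real j + 2))
          sums (odd_harm (Suc j) / (2 * real j + 2))"
    by (rule sums_divide[OF sums_odd_minus_odd])
  then show ?thesis
    by (subst inverse_product_eq[where d = "2 * real j + 2"]) (auto simp: algebra_simps)
qed

lemma sums_inverse_odd_even:
  "(\<lambda>j. 1 / ((2 * real j + 1) * (2 * real j + 2 + 2 * real i)))
     sums ((ln 2 + harm i / 2) / (2 * real i + 1))"
proof -
  have "(\<lambda>j. (1 / (2 * real j + 1) - 1 / (2 * real j + 2 + 2 * real i)) / (2 * real i + 1))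
          sums ((ln 2 + harm i / 2) / (2 * real i + 1))"
    by (rule sums_divide[OF sums_odd_minus_even])
  then show ?thesis
    by (subst inverse_product_eq[where d = "2 * real i + 1"]) (auto simp: algebra_simps)
qed

lemma sums_inverse_even_odd:
  "(\<lambda>j. 1 / ((2 * real j + 2) * (2 * real j + 3 + 2 * real i)))
     sums ((odd_harm (Suc i) - ln 2) / (2 * real i + 1))"
proof -
  have "(\<lambda>j. (1 / (2 * real j + 2) - 1 / (2 * real j + 1 + 2 * real (Suc i))) / (2 * real i + 1))
          sums ((odd_harm (Suc i) - ln 2) / (2 * real i + 1))"
    by (rule sums_divide[OF sums_even_minus_odd])
  then show ?thesis
    by (subst inverse_product_eq[where d = "2 * real i + 1"]) (auto simp: algebra_simps)
qed

lemma sum_inverse_odd_reversed: "(\<Sum>i\<le>n. 1 / (2 * real (n - i) + 1)) = odd_harm (Suc n)"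
  unfolding odd_harm_def lessThan_Suc_atMost
  by (rule sum.reindex_bij_witness[of _ "\<lambda>i. n - i" "\<lambda>i. n - i"]) auto

lemma sum_inverse_odd: "(\<Sum>i\<le>n. 1 / (2 * real i + 1)) = odd_harm (Suc n)"
  by (simp add: odd_harm_def lessThan_Suc_atMost del: odd_harm_Suc)

lemma sum_inverse_even_reversed: "(\<Sum>i\<le>n. 1 / (2 * real (n - i) + 2)) = harm (Suc n) / 2"
proof -
  have "(\<Sum>i\<le>n. 1 / (2 * real (n - i) + 2)) = (\<Sum>i\<le>n. 1 / (2 * real i + 2))"
    by (rule sum.reindex_bij_witness[of _ "\<lambda>i. n - i" "\<lambda>i. n - i"]) auto
  also have "\<dots> = harm (Suc n) / 2"
    by (induction n) (simp_all add: half_harm_Suc, simp add: harm_expand)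
  finally show ?thesis .
qed

text \<open>A sum over the diagonal \<open>i + j = n\<close> is evaluated by \<open>1 / (x * y) = (1 / x + 1 / y) / (x + y)\<close>
  whenever \<open>x + y\<close> depends on \<open>n\<close> only.\<close>

lemma sum_inverse_product:
  fixes x y :: "nat \<Rightarrow> real"
  assumes "\<And>i. i \<le> n \<Longrightarrow> 0 < x i" and "\<And>i. i \<le> n \<Longrightarrow> 0 < y i" and "\<And>i. i \<le> n \<Longrightarrow> x i + y i = s"
  shows "(\<Sum>i\<le>n. 1 / (x i * y i)) = ((\<Sum>i\<le>n. 1 / x i) + (\<Sum>i\<le>n. 1 / y i)) / s"
proof -
  have "1 / (x i * y i) = (1 / x i + 1 / y i) / s" if "i \<le> n" for i
  proof -
    have "0 < x i" "0 < y i" "s = x i + y i"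
      using assms that by auto
    then show ?thesis
      by (simp add: divide_simps)
  qed
  then show ?thesis
    by (simp add: sum.distrib flip: sum_divide_distrib)
qed


lemma sum_inverse_odd_odd:
  "(\<Sum>i\<le>n. 1 / ((2 * real i + 1) * (2 * real (n - i) + 1)))
     = (odd_harm (Suc n) + odd_harm (Suc n)) / (2 * real n + 2)"
proof -
  have "(\<Sum>i\<le>n. 1 / ((2 * real i + 1) * (2 * real (n - i) + 1)))
      = ((\<Sum>i\<le>n. 1 / (2 * real i + 1)) + (\<Sum>i\<le>n. 1 / (2 * real (n - i) + 1))) / (2 * real n + 2)"
  proof (rule sum_inverse_product)
    show "2 * real i + 1 + (2 * real (n - i) + 1) = 2 * real n + 2" if "i \<le> n" for i
      using that by (simp add: of_nat_diff)
  qed simp_all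
  then show ?thesis
    by (simp only: sum_inverse_odd sum_inverse_odd_reversed)
qed

lemma sum_inverse_odd_even:
  "(\<Sum>i\<le>n. 1 / ((2 * real i + 1) * (2 * real (n - i) + 2)))
     = (odd_harm (Suc n) + harm (Suc n) / 2) / (2 * real n + 3)"
proof -
  have "(\<Sum>i\<le>n. 1 / ((2 * real i + 1) * (2 * real (n - i) + 2)))
      = ((\<Sum>i\<le>n. 1 / (2 * real i + 1)) + (\<Sum>i\<le>n. 1 / (2 * real (n - i) + 2))) / (2 * real n + 3)"
  proof (rule sum_inverse_product)
    show "2 * real i + 1 + (2 * real (n - i) + 2) = 2 * real n + 3" if "i \<le> n" for i
      using that by (simp add: of_nat_diff)
  qed simp_all
  then show ?thesis
    by (simp only: sum_inverse_odd sum_inverse_even_reversed)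
qed

section \<open>The sums without binomial coefficients\<close>

lemma inverse_odd_squares_sums: "(\<lambda>n. 1 / (2 * real n + 1) ^ 2) sums (pi\<^sup>2 / 8)"
  using odd_power_sums[of 2 "pi\<^sup>2 / 6"] inverse_squares_sums by (simp add: add_ac)

lemma sums_inverse_pairs: "(\<lambda>n. 1 / ((real n + 1) * (2 * real n + 1))) sums (2 * ln 2)"
proof -
  have "2 * (1 / (2 * real n + 1) - 1 / (2 * real n + 2)) = 1 / ((real n + 1) * (2 * real n + 1))"
    for n
    by (simp add: divide_simps)
  then show ?thesis
    using sums_mult[OF alternating_harmonic_pairs, of 2] by simp
qed

text \<open>Write \<open>D\<close> for this sum and \<open>D'\<close> for the sum of \<open>O\<^sub>n / (n (2 n + 1))\<close>, where \<open>O\<^sub>n\<close> is the odd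
  harmonic number.  Summation by parts gives \<open>D + D' = 2 ln 2\<close>.  A second relation comes from the
  array \<open>1 / ((2 i + 1) (2 j + 1) (2 i + 2 j + 1))\<close>: its rows lead to \<open>D'\<close>, its diagonals to \<open>D\<close>.\<close>

lemma sums_odd_harm_over_pair:
  "(\<lambda>n. odd_harm (Suc n) / ((real n + 2) * (2 * real n + 3))) sums (2 * ln 2 - pi\<^sup>2 / 12)"
proof -
  define d where "d n = odd_harm (Suc n) / ((real n + 2) * (2 * real n + 3))" for n
  define d' where "d' n = odd_harm (Suc n) / ((real n + 1) * (2 * real n + 3))" for n
  have nonneg: "0 \<le> d n" "0 \<le> d' n" for n
    by (simp_all add: d_def d'_def odd_harm_nonneg del: odd_harm_Suc)
  have "(\<lambda>n. odd_harm (Suc n) * (1 / (real n + 1) - 1 / (real n + 2))) sums (2 * ln 2)"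
  proof (rule sums_odd_harm_by_parts[where T = "\<lambda>k. 1 / (real k + 1)"])
    show "(\<lambda>m. 1 / (real (k + m) + 1) - 1 / (real (k + m) + 2)) sums (1 / (real k + 1))" for k
      using telescope_inverse[of "real k + 1" 1] by (simp add: add_ac)
  qed (use sums_inverse_pairs in \<open>auto simp: field_simps\<close>)
  moreover have "odd_harm (Suc n) * (1 / (real n + 1) - 1 / (real n + 2)) = d n + d' n" for n
    unfolding d_def d'_def by (simp add: divide_simps del: odd_harm_Suc) algebra
  ultimately have sum: "(\<lambda>n. d n + d' n) sums (2 * ln 2)"
    by simp
  have "summable d" "summable d'"
    by (rule summable_comparison_test'[OF sums_summable[OF sum]]; simp add: nonneg)+
  then obtain D D' where D: "d sums D" and D': "d' sums D'"
    by (auto simp: summable_def)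
  have first: "D + D' = 2 * ln 2"
    using sums_add[OF D D'] sum by (rule sums_unique2)
  define f :: "nat \<Rightarrow> nat \<Rightarrow> real"
    where "f i j = 1 / (2 * real i + 1) * (1 / ((2 * real j + 1) * (2 * real j + 1 + 2 * real i)))" for i j
  define R where "R i = (case i of 0 \<Rightarrow> pi\<^sup>2 / 8 | Suc k \<Rightarrow> d' k / 2)" for i
  have rows: "f i sums R i" for i
  proof (cases i)
    case 0
    then show ?thesis
      using inverse_odd_squares_sums by (simp add: f_def[abs_def] R_def power2_eq_square)
  next
    case (Suc k)
    have "(\<lambda>j. 1 / (2 * real k + 3) * (1 / ((2 * real j + 1) * (2 * real j + 1 + 2 * (real k + 1)))))
        sums (1 / (2 * real k + 3) * (odd_harm (Suc k) / (2 * real k + 2)))"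
      by (intro sums_mult sums_inverse_odd_odd)
    moreover have "1 / (2 * real k + 3) * (odd_harm (Suc k) / (2 * real k + 2)) = R i"
      by (simp add: Suc R_def d'_def divide_simps del: odd_harm_Suc)
    ultimately show ?thesis
      by (simp add: Suc f_def[abs_def] add_ac)
  qed
  have "R sums (D' / 2 + pi\<^sup>2 / 8)"
    using sums_Suc[of R "D' / 2"] sums_divide[OF D', of 2] by (simp add: R_def)
  then have diag: "(\<lambda>n. \<Sum>i\<le>n. f i (n - i)) sums (D' / 2 + pi\<^sup>2 / 8)"
    by (intro sums_diagonals[OF _ rows]) (simp add: f_def)
  have "(\<Sum>i\<le>n. f i (n - i))
      = odd_harm n / ((real n + 1) * (2 * real n + 1))
        + (2 * (1 / (2 * real n + 1) ^ 2) - 1 / ((real n + 1) * (2 * real n + 1)))" for n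
  proof -
    have "f i (n - i) = 1 / ((2 * real i + 1) * (2 * real (n - i) + 1)) / (2 * real n + 1)"
      if "i \<le> n" for i
      using that by (simp add: f_def of_nat_diff algebra_simps)
    then have "(\<Sum>i\<le>n. f i (n - i))
        = (\<Sum>i\<le>n. 1 / ((2 * real i + 1) * (2 * real (n - i) + 1))) / (2 * real n + 1)"
      by (simp add: sum_divide_distrib)
    also have "\<dots> = (odd_harm (Suc n) + odd_harm (Suc n)) / (2 * real n + 2) / (2 * real n + 1)"
      by (simp only: sum_inverse_odd_odd)
    also have "\<dots> = odd_harm n / ((real n + 1) * (2 * real n + 1))
        + (2 * (1 / (2 * real n + 1) ^ 2) - 1 / ((real n + 1) * (2 * real n + 1)))"
      by (simp add: divide_simps) algebra
    finally show ?thesis .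
  qed
  with diag have diag': "(\<lambda>n. odd_harm n / ((real n + 1) * (2 * real n + 1))
        + (2 * (1 / (2 * real n + 1) ^ 2) - 1 / ((real n + 1) * (2 * real n + 1))))
      sums (D' / 2 + pi\<^sup>2 / 8)"
    by simp
  have "(\<lambda>n. odd_harm n / ((real n + 1) * (2 * real n + 1))) sums D"
    using sums_Suc[of "\<lambda>n. odd_harm n / ((real n + 1) * (2 * real n + 1))" D] D
    unfolding d_def[abs_def] by (simp add: add_ac distrib_left del: odd_harm_Suc)
  then have "(\<lambda>n. odd_harm n / ((real n + 1) * (2 * real n + 1))
        + (2 * (1 / (2 * real n + 1) ^ 2) - 1 / ((real n + 1) * (2 * real n + 1))))
      sums (D + (2 * (pi\<^sup>2 / 8) - 2 * ln 2))"
    by (intro sums_add sums_diff sums_mult inverse_odd_squares_sums sums_inverse_pairs)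
  with diag' have "D' / 2 + pi\<^sup>2 / 8 = D + (2 * (pi\<^sup>2 / 8) - 2 * ln 2)"
    by (rule sums_unique2)
  with first have "D = 2 * ln 2 - pi\<^sup>2 / 12"
    by (simp add: field_simps)
  with D show ?thesis
    by (simp add: d_def[abs_def])
qed

lemma inverse_odd_cubes_sums: "(\<lambda>n. 1 / (2 * real n + 1) ^ 3) sums (7 / 8 * zeta 3)"
proof -
  have "summable (\<lambda>n. 1 / real n ^ 3)"
    using inverse_power_summable[of 3, where ?'a = real] by (simp add: inverse_eq_divide)
  then have "summable (\<lambda>n. 1 / real (Suc n) ^ 3)"
    by (subst summable_Suc_iff)
  then have "(\<lambda>n. 1 / real (Suc n) ^ 3) sums zeta 3"
    by (simp add: zeta_def summable_sums)
  then have "(\<lambda>n. 1 / (real n + 1) ^ 3) sums zeta 3"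
    by (simp add: add_ac)
  from odd_power_sums[OF this] show ?thesis
    by simp
qed

text \<open>Let \<open>T\<close> and \<open>X\<close> be the sums of \<open>O\<^sub>n / (2 n + 1)\<^sup>2\<close> and of \<open>H\<^sub>n / (2 (2 n + 1)\<^sup>2)\<close>.  Two arrays of the
  shape \<open>1 / (a b (a + b))\<close> are used: \<open>f\<close> with \<open>a\<close> odd and \<open>b\<close> even, and \<open>g\<close> with both odd.  In \<open>f\<close> the
  diagonals give \<open>T + X\<close> and the rows give \<open>T\<close> plus known constants, which determines \<open>X\<close>.  The rows of
  \<open>g\<close> involve only \<open>X\<close>, so the total of \<open>g\<close> is known as well.  Finally the diagonals of \<open>g\<close> are twice
  the columns of \<open>f\<close>, so that \<open>T + X\<close> is half of the total of \<open>g\<close>.\<close>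

lemma sums_odd_harm_over_odd_square:
  "(\<lambda>n. odd_harm (Suc n) / (2 * real n + 3) ^ 2) sums (pi\<^sup>2 / 8 * ln 2 - 7 / 16 * zeta 3)"
proof -
  define z where "z = 7 / 8 * zeta 3"
  define t where "t n = odd_harm n / (2 * real n + 1) ^ 2" for n
  define x where "x n = harm n / 2 / (2 * real n + 1) ^ 2" for n
  note cubes = inverse_odd_cubes_sums[folded z_def]
  note squares = inverse_odd_squares_sums
  have "summable (\<lambda>n. t (Suc n))"
  proof (rule summable_comparison_test'[OF sums_summable[OF sums_odd_harm_over_pair]])
    fix n :: nat
    have "(real n + 2) * (2 * real n + 3) \<le> (2 * real n + 3) ^ 2"
      by (simp add: power2_eq_square mult_right_mono)
    then have "odd_harm (Suc n) / (2 * real n + 3) ^ 2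
        \<le> odd_harm (Suc n) / ((real n + 2) * (2 * real n + 3))"
      by (intro divide_left_mono odd_harm_nonneg) auto
    moreover have "norm (t (Suc n)) = odd_harm (Suc n) / (2 * real n + 3) ^ 2"
      by (simp add: t_def odd_harm_nonneg add_ac del: odd_harm_Suc)
    ultimately show "norm (t (Suc n)) \<le> odd_harm (Suc n) / ((real n + 2) * (2 * real n + 3))"
      by simp
  qed
  then have t: "summable t"
    by (subst (asm) summable_Suc_iff)
  have "summable x"
  proof (rule summable_comparison_test'[OF t])
    fix n
    have "x n \<le> t n"
      unfolding x_def t_def by (intro divide_right_mono harm_le_odd_harm) simp
    moreover have "0 \<le> x n"
      by (simp add: x_def harm_nonneg)
    ultimately show "norm (x n) \<le> t n"
      by simp
  qed
  with t obtain T X where T: "t sums T" and X: "x sums X"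
    by (auto simp: summable_def)

  define f :: "nat \<Rightarrow> nat \<Rightarrow> real"
    where "f i j = 1 / ((2 * real i + 1) * (2 * real j + 2) * (2 * real i + 2 * real j + 3))" for i j
  have f_nonneg: "0 \<le> f i j" for i j
    by (simp add: f_def)
  define R where "R i = t i + 1 / (2 * real i + 1) ^ 3 - ln 2 * (1 / (2 * real i + 1) ^ 2)" for i
  have f_rows: "f i sums R i" for i
  proof -
    have "(\<lambda>j. 1 / (2 * real i + 1) * (1 / ((2 * real j + 2) * (2 * real j + 3 + 2 * real i))))
        sums (1 / (2 * real i + 1) * ((odd_harm (Suc i) - ln 2) / (2 * real i + 1)))"
      by (intro sums_mult sums_inverse_even_odd)
    moreover have "1 / (2 * real i + 1) * ((odd_harm (Suc i) - ln 2) / (2 * real i + 1)) = R i"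
      by (simp add: R_def t_def power2_eq_square power3_eq_cube diff_divide_distrib add_divide_distrib)
    ultimately show ?thesis
      by (simp add: f_def[abs_def] mult_ac add_ac)
  qed
  have R: "R sums (T + z - ln 2 * (pi\<^sup>2 / 8))"
    unfolding R_def by (intro sums_add sums_diff sums_mult T cubes squares)
  have "(\<Sum>i\<le>n. f i (n - i)) = t (Suc n) + x (Suc n)" for n
  proof -
    have "f i (n - i) = 1 / ((2 * real i + 1) * (2 * real (n - i) + 2)) / (2 * real n + 3)"
      if "i \<le> n" for i
      using that by (simp add: f_def of_nat_diff algebra_simps)
    then have "(\<Sum>i\<le>n. f i (n - i))
        = (\<Sum>i\<le>n. 1 / ((2 * real i + 1) * (2 * real (n - i) + 2))) / (2 * real n + 3)"
      by (simp add: sum_divide_distrib)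
    also have "\<dots> = (odd_harm (Suc n) + harm (Suc n) / 2) / (2 * real n + 3) / (2 * real n + 3)"
      by (simp only: sum_inverse_odd_even)
    finally show ?thesis
      by (simp add: t_def x_def power2_eq_square add_divide_distrib add_ac del: odd_harm_Suc)
  qed
  with sums_diagonals[OF f_nonneg f_rows R]
  have "(\<lambda>n. t (Suc n) + x (Suc n)) sums (T + z - ln 2 * (pi\<^sup>2 / 8))"
    by simp
  from sums_Suc[of "\<lambda>n. t n + x n", OF this]
  have "(\<lambda>n. t n + x n) sums (T + z - ln 2 * (pi\<^sup>2 / 8))"
    by (simp add: t_def x_def harm_expand(1))
  from sums_unique2[OF sums_add[OF T X] this] have X_eq: "X = z - ln 2 * (pi\<^sup>2 / 8)"
    by simp

  define g :: "nat \<Rightarrow> nat \<Rightarrow> real"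
    where "g i j = 1 / ((2 * real i + 1) * (2 * real j + 1) * (2 * real i + 2 * real j + 2))" for i j
  have g_rows: "g i sums (x i + ln 2 * (1 / (2 * real i + 1) ^ 2))" for i
  proof -
    have "(\<lambda>j. 1 / (2 * real i + 1) * (1 / ((2 * real j + 1) * (2 * real j + 2 + 2 * real i))))
        sums (1 / (2 * real i + 1) * ((ln 2 + harm i / 2) / (2 * real i + 1)))"
      by (intro sums_mult sums_inverse_odd_even)
    moreover have "1 / (2 * real i + 1) * ((ln 2 + harm i / 2) / (2 * real i + 1))
        = x i + ln 2 * (1 / (2 * real i + 1) ^ 2)"
      by (simp add: x_def power2_eq_square add_divide_distrib)
    ultimately show ?thesis
      by (simp add: g_def[abs_def] mult_ac add_ac)
  qed
  have "(\<lambda>i. x i + ln 2 * (1 / (2 * real i + 1) ^ 2)) sums (X + ln 2 * (pi\<^sup>2 / 8))"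
    by (intro sums_add sums_mult X squares)
  then have "(\<lambda>n. \<Sum>i\<le>n. g i (n - i)) sums z"
    by (intro sums_diagonals[OF _ g_rows]) (simp_all add: g_def X_eq)
  moreover have "(\<Sum>i\<le>n. g i (n - i)) = 2 * (odd_harm (Suc n) / (2 * real n + 2) ^ 2)" for n
  proof -
    have "g i (n - i) = 1 / ((2 * real i + 1) * (2 * real (n - i) + 1)) / (2 * real n + 2)"
      if "i \<le> n" for i
      using that by (simp add: g_def of_nat_diff algebra_simps)
    then have "(\<Sum>i\<le>n. g i (n - i))
        = (\<Sum>i\<le>n. 1 / ((2 * real i + 1) * (2 * real (n - i) + 1))) / (2 * real n + 2)"
      by (simp add: sum_divide_distrib)
    also have "\<dots> = (odd_harm (Suc n) + odd_harm (Suc n)) / (2 * real n + 2) / (2 * real n + 2)"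
      by (simp only: sum_inverse_odd_odd)
    finally show ?thesis
      by (simp add: power2_eq_square del: odd_harm_Suc)
  qed
  ultimately have "(\<lambda>n. 2 * (odd_harm (Suc n) / (2 * real n + 2) ^ 2)) sums z"
    by simp
  from sums_mult[OF this, of "1 / 2"]
  have g_total: "(\<lambda>n. odd_harm (Suc n) / (2 * real n + 2) ^ 2) sums (z / 2)"
    by (simp del: odd_harm_Suc)

  have "(\<lambda>i. f i j) sums (odd_harm (Suc j) / (2 * real j + 2) ^ 2)" for j
  proof -
    have "(\<lambda>i. 1 / (2 * real j + 2)
          * (1 / ((2 * real i + 1) * (2 * real i + 1 + 2 * (real j + 1)))))
        sums (1 / (2 * real j + 2) * (odd_harm (Suc j) / (2 * real j + 2)))"
      by (intro sums_mult sums_inverse_odd_odd)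
    then show ?thesis
      by (simp add: f_def power2_eq_square mult_ac add_ac distrib_left del: odd_harm_Suc)
  qed
  from sums_columns[OF f_nonneg f_rows R this]
  have "T + z - ln 2 * (pi\<^sup>2 / 8) = z / 2"
    using g_total by (rule sums_unique2)
  then have "T = ln 2 * (pi\<^sup>2 / 8) - z / 2"
    by linarith
  then have "T = pi\<^sup>2 / 8 * ln 2 - 7 / 16 * zeta 3"
    by (simp add: z_def)
  with T have "t sums (pi\<^sup>2 / 8 * ln 2 - 7 / 16 * zeta 3)"
    by simp
  moreover have "t 0 = 0"
    by (simp add: t_def)
  ultimately have "(\<lambda>n. t (Suc n)) sums (pi\<^sup>2 / 8 * ln 2 - 7 / 16 * zeta 3)"
    by (simp add: sums_Suc_iff)
  then show ?thesis
    by (simp add: t_def add_ac del: odd_harm_Suc)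
qed


section \<open>Normalised central binomial coefficients\<close>

definition cbin :: "nat \<Rightarrow> real" where
  "cbin n = real ((2 * n) choose n) / 4 ^ n"

lemma cbin_0 [simp]: "cbin 0 = 1"
  by (simp add: cbin_def)

lemma cbin_pos [simp]: "0 < cbin n"
  by (simp add: cbin_def zero_less_binomial)

lemma cbin_nonneg [simp]: "0 \<le> cbin n"
  by (simp add: less_imp_le)

lemma cbin_neq_0 [simp]: "cbin n \<noteq> 0"
  using cbin_pos[of n] by linarith

lemma cbin_Suc: "cbin (Suc n) = (2 * real n + 1) / (2 * real n + 2) * cbin n"
proof -
  have "Suc n * ((2 * n + 2) choose Suc n) = (2 * n + 2) * ((2 * n + 1) choose n)"
    using Suc_times_binomial_eq[of "2 * n + 1" n] by (simp add: mult_ac)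
  moreover have "Suc n * ((2 * n + 1) choose n) = (2 * n + 1) * ((2 * n) choose n)"
    using Suc_times_binomial_eq[of "2 * n" n] binomial_symmetric[of n "2 * n + 1"]
    by (simp add: mult_ac)
  ultimately have "Suc n * (Suc n * ((2 * n + 2) choose Suc n))
      = (2 * n + 2) * ((2 * n + 1) * ((2 * n) choose n))"
    by (metis mult.left_commute)
  then have "real (Suc n * (Suc n * ((2 * n + 2) choose Suc n)))
      = real ((2 * n + 2) * ((2 * n + 1) * ((2 * n) choose n)))"
    by (simp only:)
  then have "(real n + 1) * ((real n + 1) * real ((2 * n + 2) choose Suc n))
      = (real n + 1) * (2 * ((2 * real n + 1) * real ((2 * n) choose n)))"
    by (simp add: algebra_simps)
  then have "(real n + 1) * real ((2 * n + 2) choose Suc n)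
      = 2 * ((2 * real n + 1) * real ((2 * n) choose n))"
    by simp
  then show ?thesis
    by (simp add: cbin_def divide_simps) (simp add: algebra_simps)
qed

lemma cbin_diff: "cbin n - cbin (Suc n) = cbin n / (2 * real n + 2)"
  by (simp add: cbin_Suc field_simps)

lemma cbin_eq_double_fact_ratio:
  "cbin n * (real (double_fact (2 * n)) / real (double_fact (2 * n + 1))) = 1 / (2 * real n + 1)"
proof (induction n)
  case 0
  show ?case by (simp add: double_fact_def)
next
  case (Suc n)
  define e o' where "e = real (double_fact (2 * n))" and "o' = real (double_fact (2 * n + 1))"
  have "real (double_fact (2 * Suc n)) = e * (2 * real n + 2)"
    unfolding double_fact_even e_def by (simp add: algebra_simps)
  moreover have "real (double_fact (2 * Suc n + 1)) = o' * (2 * real n + 3)"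
    unfolding double_fact_odd o'_def by (simp add: algebra_simps)
  moreover have "o' \<noteq> 0"
    unfolding double_fact_def o'_def by (auto simp: prod_zero_iff)
  moreover have "cbin n * (e / o') = 1 / (2 * real n + 1)"
    using Suc by (simp add: e_def o'_def)
  ultimately show ?case
    by (simp add: cbin_Suc divide_simps) (simp add: algebra_simps)
qed

text \<open>This form of Wallis' product gives both the decay of \<open>cbin\<close> and the value of the arcsine series
  at \<open>1\<close>.\<close>

lemma cbin_sq_eq_wallis:
  "(2 * real n + 1) * (cbin n)\<^sup>2 = inverse (\<Prod>k=1..n. (4 * real k ^ 2) / (4 * real k ^ 2 - 1))"
proof (induction n)
  case (Suc n)
  have "(2 * real (Suc n) + 1) * (cbin (Suc n))\<^sup>2
      = (2 * real n + 1) * (cbin n)\<^sup>2 * ((2 * real n + 1) * (2 * real n + 3) / (2 * real n + 2)\<^sup>2)"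
    by (simp add: cbin_Suc power2_eq_square divide_simps)
  also have "(2 * real n + 1) * (2 * real n + 3) / (2 * real n + 2)\<^sup>2
      = inverse ((4 * real (Suc n) ^ 2) / (4 * real (Suc n) ^ 2 - 1))"
    by (simp add: power2_eq_square algebra_simps)
  finally have "(2 * real (Suc n) + 1) * (cbin (Suc n))\<^sup>2
      = inverse ((\<Prod>k=1..n. (4 * real k ^ 2) / (4 * real k ^ 2 - 1))
          * ((4 * real (Suc n) ^ 2) / (4 * real (Suc n) ^ 2 - 1)))"
    by (simp only: Suc inverse_mult_distrib)
  then show ?case
    by simp
qed simp

lemma cbin_sq_limit: "(\<lambda>n. (2 * real n + 1) * (cbin n)\<^sup>2) \<longlonglongrightarrow> 2 / pi"
  using tendsto_inverse[OF wallis] by (simp add: cbin_sq_eq_wallis)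

lemma cbin_tendsto_0: "cbin \<longlonglongrightarrow> 0"
proof -
  have "(\<lambda>n. 1 / (2 * real n + 1)) \<longlonglongrightarrow> 0"
    by real_asymp
  from tendsto_mult[OF cbin_sq_limit this]
  have "(\<lambda>n. (2 * real n + 1) * (cbin n)\<^sup>2 * (1 / (2 * real n + 1))) \<longlonglongrightarrow> 0"
    by simp
  moreover have "(2 * real n + 1) * (cbin n)\<^sup>2 * (1 / (2 * real n + 1)) = (cbin n)\<^sup>2" for n
  proof -
    have "2 * real n + 1 \<noteq> 0"
      by linarith
    then show ?thesis
      by simp
  qed
  ultimately have "(\<lambda>n. (cbin n)\<^sup>2) \<longlonglongrightarrow> 0"
    by simp
  from tendsto_real_sqrt[OF this] show ?thesis
    by simp
qed

lemma cbin_over_even_sums: "(\<lambda>n. cbin n / (2 * real n + 2)) sums 1"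
  using telescope_sums'[OF cbin_tendsto_0] by (simp add: cbin_diff)

text \<open>Raising the shift \<open>s\<close> by 2 multiplies the sum by \<open>s / (s + 1)\<close>, because
  \<open>s / (2 m + s) - (s + 1) / (2 m + s + 2)\<close> times \<open>cbin m\<close> is a difference of consecutive values of
  \<open>2 m cbin m / (2 m + s)\<close>.\<close>

lemma cbin_shift_sums:
  fixes s c :: real
  assumes "0 < s" and "(\<lambda>m. cbin m / (2 * real m + s)) sums c"
  shows "(\<lambda>m. cbin m / (2 * real m + s + 2)) sums (s / (s + 1) * c)"
proof -
  define v where "v m = 2 * real m * cbin m / (2 * real m + s)" for m
  have "v \<longlonglongrightarrow> 0"
  proof (rule Lim_null_comparison[OF always_eventually cbin_tendsto_0])
    show "\<forall>m. norm (v m) \<le> cbin m"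
      using assms(1) by (auto simp: v_def divide_simps intro!: mult_right_mono)
  qed
  then have "(\<lambda>m. v (Suc m) - v m) sums 0"
    using telescope_sums[of v 0] by (simp add: v_def)
  moreover have v_Suc: "v (Suc m) = (2 * real m + 1) * cbin m / (2 * real m + s + 2)" for m
    using assms(1) by (simp add: v_def cbin_Suc divide_simps) (simp add: algebra_simps)
  have "v (Suc m) - v m
      = s * (cbin m / (2 * real m + s)) - (s + 1) * (cbin m / (2 * real m + s + 2))" for m
    unfolding v_Suc using assms(1) by (simp add: v_def divide_simps) (simp add: algebra_simps)
  ultimately have "(\<lambda>m. s * (cbin m / (2 * real m + s)) - (s + 1) * (cbin m / (2 * real m + s + 2))) sums 0"
    by simp
  from sums_diff[OF sums_mult[OF assms(2), of s] this]
  have "(\<lambda>m. (s + 1) * (cbin m / (2 * real m + s + 2))) sums (s * c)"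
    by simp
  from sums_divide[OF this, of "s + 1"] show ?thesis
    using assms(1) by simp
qed

lemma cbin_over_even_shift_sums:
  "(\<lambda>m. cbin m / (2 * real m + 2 * real j + 2)) sums (1 / ((2 * real j + 2) * cbin (Suc j)))"
proof (induction j)
  case 0
  show ?case using cbin_over_even_sums by (simp add: cbin_Suc)
next
  case (Suc j)
  have "(\<lambda>m. cbin m / (2 * real m + (2 * real j + 2))) sums (1 / ((2 * real j + 2) * cbin (Suc j)))"
    using Suc by (simp add: add_ac)
  from cbin_shift_sums[OF _ this] show ?case
    by (simp add: cbin_Suc[of "Suc j"] add_ac)
qed

lemma cbin_over_odd_shift_sums:
  assumes "(\<lambda>m. cbin m / (2 * real m + 1)) sums u"
  shows "(\<lambda>m. cbin m / (2 * real m + 2 * real k + 1)) sums (u * cbin k)"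
proof (induction k)
  case 0
  show ?case using assms by simp
next
  case (Suc k)
  have "(\<lambda>m. cbin m / (2 * real m + (2 * real k + 1))) sums (u * cbin k)"
    using Suc by (simp add: add_ac)
  from cbin_shift_sums[OF _ this] show ?case
    by (simp add: cbin_Suc add_ac mult_ac)
qed

text \<open>The numbers \<open>- cbin j / (2 j - 1)\<close> are the coefficients of \<open>sqrt (1 - y)\<close>, and \<open>cbin j\<close> those of
  \<open>1 / sqrt (1 - y)\<close>.  The product of the two power series is \<open>1\<close>, so the convolution vanishes in
  positive degree; the right-hand side is the term of index \<open>0\<close>, moved across.\<close>

lemma cbin_convolution_odd:
  "(\<Sum>j\<le>n. cbin (Suc j) / (2 * real j + 1) * cbin (n - j)) = cbin (Suc n)"
proof -
  define N where "N = Suc n"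
  define h where "h j = cbin j * cbin (N - j) / (2 * real j - 1)" for j
  \<comment> \<open>An antidifference of \<open>- 2 N h\<close>, as found by Gosper's algorithm; it vanishes at \<open>0\<close>.  The
      sum is telescoped only up to \<open>j = N - 1\<close>, since \<open>N - Suc j\<close> is truncated at \<open>j = N\<close>; the
      remaining term cancels \<open>Z N\<close>.\<close>
  define Z where "Z j = 2 * real j * (2 * (real N - real j) + 1) / (2 * real j - 1)
      * cbin j * cbin (N - j)" for j
  have odd_neq: "2 * real j - 1 \<noteq> 0" for j
  proof
    assume "2 * real j - 1 = 0"
    then have "real (2 * j) = real 1"
      by simp
    then show False
      by (simp only: of_nat_eq_iff) presburger
  qed
  have "Z (Suc j) - Z j = - 2 * real N * h j" if "j < N" for j
  proof -
    obtain i where i: "N = j + Suc i"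
      using \<open>j < N\<close> less_iff_Suc_add by auto
    have 1: "cbin (N - j) = (2 * real i + 1) / (2 * real i + 2) * cbin i" "N - Suc j = i"
      by (simp_all add: i cbin_Suc)
    have 2: "real N = real j + real i + 1"
      by (simp add: i)
    show ?thesis
      unfolding Z_def h_def 1 2 cbin_Suc[of j] using odd_neq[of j]
      by (simp add: divide_simps) algebra
  qed
  then have "(\<Sum>j<N. Z (Suc j) - Z j) = (\<Sum>j<N. - 2 * real N * h j)"
    by (intro sum.cong) auto
  then have "Z N - Z 0 = - 2 * real N * (\<Sum>j<N. h j)"
    by (simp add: sum_lessThan_telescope sum_distrib_left)
  moreover have "Z N = 2 * real N * h N"
    by (simp add: Z_def h_def)
  moreover have "Z 0 = 0"
    by (simp add: Z_def)
  ultimately have "2 * real N * (\<Sum>j\<le>N. h j) = 0"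
    by (simp add: lessThan_Suc_atMost[symmetric] distrib_left)
  then have "(\<Sum>j\<le>Suc n. h j) = 0"
    by (simp add: N_def)
  then have "h 0 + (\<Sum>j\<le>n. h (Suc j)) = 0"
    by (simp only: sum.atMost_Suc_shift)
  then show ?thesis
    by (simp add: h_def N_def algebra_simps)
qed

text \<open>The factor \<open>cbin (Suc j)\<close> cancels in the row sums, which leaves the pairs of the alternating
  harmonic series, while the convolution above collapses the diagonals.\<close>

lemma cbin_over_even_Suc_sums: "(\<lambda>n. cbin (Suc n) / (2 * real n + 2)) sums ln 2"
proof -
  define f :: "nat \<Rightarrow> nat \<Rightarrow> real" where
    "f j k = cbin (Suc j) / (2 * real j + 1) * (cbin k / (2 * real k + 2 * real j + 2))" for j k
  have rows: "f j sums (1 / (2 * real j + 1) - 1 / (2 * real j + 2))" for j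
  proof -
    have "f j sums (cbin (Suc j) / (2 * real j + 1) * (1 / ((2 * real j + 2) * cbin (Suc j))))"
      unfolding f_def[abs_def] by (intro sums_mult cbin_over_even_shift_sums)
    also have "cbin (Suc j) / (2 * real j + 1) * (1 / ((2 * real j + 2) * cbin (Suc j)))
        = 1 / (2 * real j + 1) - 1 / (2 * real j + 2)"
      by (simp add: divide_simps)
    finally show ?thesis .
  qed
  have "(\<lambda>n. \<Sum>j\<le>n. f j (n - j)) sums ln 2"
    by (rule sums_diagonals[OF _ rows alternating_harmonic_pairs]) (simp add: f_def)
  moreover have "(\<Sum>j\<le>n. f j (n - j)) = cbin (Suc n) / (2 * real n + 2)" for n
    unfolding cbin_convolution_odd[of n, symmetric] sum_divide_distrib
    by (intro sum.cong) (auto simp: f_def of_nat_diff)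
  ultimately show ?thesis
    by simp
qed

lemma cbin_sq_sum:
  "(\<Sum>j<n. (cbin (Suc j))\<^sup>2 / (2 * real j + 1)) = 1 - (2 * real n + 1) * (cbin n)\<^sup>2"
proof (induction n)
  case (Suc n)
  have "(cbin (Suc n))\<^sup>2 / (2 * real n + 1)
      = (2 * real n + 1) * (cbin n)\<^sup>2 - (2 * real n + 3) * (cbin (Suc n))\<^sup>2"
    by (simp add: cbin_Suc power2_eq_square divide_simps) algebra
  then show ?case
    using Suc by simp
qed simp

text \<open>Let \<open>u\<close> be the sum.  The array \<open>f\<close> has rows with total \<open>u (1 - 2 / \<pi>)\<close> by Wallis' product, and its
  diagonals are the terms of the series itself except for the first, with total \<open>u - 1\<close>.  The
  resulting linear equation gives \<open>u = \<pi> / 2\<close>.\<close>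

lemma arcsin_series_at_1: "(\<lambda>n. cbin n / (2 * real n + 1)) sums (pi / 2)"
proof -
  have "summable (\<lambda>n. cbin n / (2 * real n + 1))"
  proof (rule summable_comparison_test'[OF summable_mult[OF sums_summable[OF cbin_over_even_sums], of 2]])
    show "norm (cbin n / (2 * real n + 1)) \<le> 2 * (cbin n / (2 * real n + 2))" for n
      by (simp add: divide_simps)
  qed
  then obtain u where u: "(\<lambda>n. cbin n / (2 * real n + 1)) sums u"
    by (auto simp: summable_def)
  define f :: "nat \<Rightarrow> nat \<Rightarrow> real" where
    "f j m = cbin (Suc j) / (2 * real j + 1) * (cbin m / (2 * real m + 2 * real (Suc j) + 1))" for j m
  have rows: "f j sums (cbin (Suc j) / (2 * real j + 1) * (u * cbin (Suc j)))" for j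
    unfolding f_def[abs_def] by (intro sums_mult cbin_over_odd_shift_sums u)
  have "(\<lambda>j. (cbin (Suc j))\<^sup>2 / (2 * real j + 1)) sums (1 - 2 / pi)"
    unfolding sums_def cbin_sq_sum by (intro tendsto_diff tendsto_const cbin_sq_limit)
  from sums_mult[OF this, of u]
  have "(\<lambda>j. cbin (Suc j) / (2 * real j + 1) * (u * cbin (Suc j))) sums (u * (1 - 2 / pi))"
    by (simp add: power2_eq_square mult_ac)
  then have "(\<lambda>n. \<Sum>j\<le>n. f j (n - j)) sums (u * (1 - 2 / pi))"
    by (rule sums_diagonals[OF _ rows, rotated]) (simp add: f_def)
  moreover have "(\<Sum>j\<le>n. f j (n - j)) = cbin (Suc n) / (2 * real (Suc n) + 1)" for n
    unfolding cbin_convolution_odd[of n, symmetric] sum_divide_distrib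
    by (intro sum.cong) (auto simp: f_def of_nat_diff)
  ultimately have "(\<lambda>n. cbin (Suc n) / (2 * real (Suc n) + 1)) sums (u * (1 - 2 / pi))"
    by simp
  moreover have "(\<lambda>n. cbin (Suc n) / (2 * real (Suc n) + 1)) sums (u - 1)"
    unfolding sums_Suc_iff[of "\<lambda>n. cbin n / (2 * real n + 1)" "u - 1"] using u by simp
  ultimately have "u * (1 - 2 / pi) = u - 1"
    by (rule sums_unique2)
  then have "u = pi / 2"
    by (simp add: field_simps)
  with u show ?thesis
    by simp
qed

text \<open>Both sides are half of the coefficient of \<open>y ^ (n + 1)\<close> in \<open>- ln (1 - y) / sqrt (1 - y)\<close>.  The
  induction step uses that \<open>(n + 2) c\<^bsub>n+2\<^esub> - (n + 3/2) c\<^bsub>n+1\<^esub> = cbin (n + 1)\<close> for these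
  coefficients \<open>c\<close>; on the convolution side the difference telescopes.\<close>

lemma cbin_convolution_harmonic:
  "(\<Sum>k\<le>n. cbin (n - k) / (2 * real k + 2)) = cbin (Suc n) * odd_harm (Suc n)"
proof (induction n)
  case 0
  show ?case by (simp add: cbin_Suc)
next
  case (Suc n)
  have step: "(2 * real n + 4) * (cbin (Suc n - k) / (2 * real k + 2))
      - (2 * real n + 3) * (cbin (n - k) / (2 * real k + 2)) = cbin (Suc n - k) - cbin (n - k)"
    if "k \<le> n" for k
  proof -
    define i where "i = n - k"
    have i: "n - k = i" "Suc n - k = Suc i" "real n = real k + real i"
      using that by (auto simp: i_def of_nat_diff)
    have alg: "(a + b) * (y / a) - (a + c) * (x / a) = y - x"
      if "0 < a" "b * y = c * x" for a b c x y :: real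
      using that by (simp add: field_simps)
    have "(2 * real i + 2) * cbin (Suc i) = (2 * real i + 1) * cbin i"
      by (simp add: cbin_Suc)
    from alg[OF _ this, of "2 * real k + 2"] show ?thesis
      unfolding i by (simp add: algebra_simps)
  qed
  have "(2 * real n + 4) * (\<Sum>k\<le>n. cbin (Suc n - k) / (2 * real k + 2))
      - (2 * real n + 3) * (\<Sum>k\<le>n. cbin (n - k) / (2 * real k + 2))
      = (\<Sum>k\<le>n. cbin (Suc n - k) - cbin (n - k))"
    unfolding sum_distrib_left sum_subtractf[symmetric] by (intro sum.cong step) auto
  also have "\<dots> = (\<Sum>k\<le>n. cbin (Suc n - k) - cbin (Suc n - Suc k))"
    by simp
  also have "\<dots> = cbin (Suc n) - 1"
    using sum_telescope[of "\<lambda>k. cbin (Suc n - k)" n] by simp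
  finally have "(2 * real n + 4) * (\<Sum>k\<le>n. cbin (Suc n - k) / (2 * real k + 2))
      - (2 * real n + 3) * (\<Sum>k\<le>n. cbin (n - k) / (2 * real k + 2)) = cbin (Suc n) - 1" .
  moreover have "(2 * real n + 4) * (\<Sum>k\<le>Suc n. cbin (Suc n - k) / (2 * real k + 2))
      = (2 * real n + 4) * (\<Sum>k\<le>n. cbin (Suc n - k) / (2 * real k + 2)) + 1"
    by (simp add: distrib_left)
  ultimately have "(2 * real n + 4) * (\<Sum>k\<le>Suc n. cbin (Suc n - k) / (2 * real k + 2))
      = (2 * real n + 3) * (cbin (Suc n) * odd_harm (Suc n)) + cbin (Suc n)"
    unfolding Suc.IH by linarith
  also have "\<dots> = (2 * real n + 4) * (cbin (Suc (Suc n)) * odd_harm (Suc (Suc n)))"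
  proof -
    have shift: "2 * real (Suc n) + 1 = 2 * real n + 3" "2 * real (Suc n) + 2 = 2 * real n + 4"
      by simp_all
    have alg: "a * (c * h) + c = b * (a / b * c * (h + 1 / a))" if "0 < a" "0 < b" for a b c h :: real
      using that by (simp add: field_simps)
    show ?thesis
      unfolding cbin_Suc[of "Suc n"] odd_harm_Suc[of "Suc n"] shift
      by (rule alg) simp_all
  qed
  finally show ?case
    by (simp only: mult_cancel_left) linarith
qed

text \<open>The convolution above resolves \<open>cbin * odd_harm\<close> into an array whose rows are shifts of the
  arcsine series at \<open>1\<close>, hence \<open>\<pi> / 2\<close> times \<open>cbin\<close>.\<close>

lemma sums_cbin_odd_harm_over_odd:
  "(\<lambda>n. cbin (Suc n) * odd_harm (Suc n) / (2 * real n + 3)) sums (pi / 2 * ln 2)"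
proof -
  define f :: "nat \<Rightarrow> nat \<Rightarrow> real" where
    "f k m = 1 / (2 * real k + 2) * (cbin m / (2 * real m + 2 * real (Suc k) + 1))" for k m
  have rows: "f k sums (1 / (2 * real k + 2) * (pi / 2 * cbin (Suc k)))" for k
    unfolding f_def[abs_def] by (intro sums_mult cbin_over_odd_shift_sums arcsin_series_at_1)
  have "(\<lambda>k. 1 / (2 * real k + 2) * (pi / 2 * cbin (Suc k))) sums (pi / 2 * ln 2)"
    using sums_mult[OF cbin_over_even_Suc_sums, of "pi / 2"] by (simp add: mult_ac)
  then have "(\<lambda>n. \<Sum>k\<le>n. f k (n - k)) sums (pi / 2 * ln 2)"
    by (rule sums_diagonals[OF _ rows, rotated]) (simp add: f_def)
  moreover have "(\<Sum>k\<le>n. f k (n - k)) = cbin (Suc n) * odd_harm (Suc n) / (2 * real n + 3)" for n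
    unfolding cbin_convolution_harmonic[of n, symmetric] sum_divide_distrib
    by (intro sum.cong) (auto simp: f_def of_nat_diff)
  ultimately show ?thesis
    by simp
qed

lemma sums_cbin_odd_harm_over_even:
  "(\<lambda>n. cbin (Suc n) * odd_harm (Suc n) / (2 * real n + 4)) sums 1"
proof -
  have "(\<lambda>n. odd_harm (Suc n) * (cbin (Suc n) - cbin (Suc (Suc n)))) sums 1"
  proof (rule sums_odd_harm_by_parts[where T = "\<lambda>k. cbin (Suc k)"])
    show "0 \<le> cbin (Suc n) - cbin (Suc (Suc n))" for n
      by (simp add: cbin_diff)
    show "(\<lambda>m. cbin (Suc (k + m)) - cbin (Suc (Suc (k + m)))) sums cbin (Suc k)" for k
      using telescope_sums'[OF LIMSEQ_ignore_initial_segment[OF cbin_tendsto_0, of "Suc k"]]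
      by (simp add: add_ac)
    have "cbin (Suc k) / (2 * real k + 1) = cbin k / (2 * real k + 2)" for k
      by (simp add: cbin_Suc)
    then show "(\<lambda>k. cbin (Suc k) / (2 * real k + 1)) sums 1"
      using cbin_over_even_sums by simp
  qed
  then show ?thesis
    by (simp add: cbin_diff add_ac mult_ac del: odd_harm_Suc)
qed

section \<open>Evaluation of the series\<close>

theorem theorem2p3:
  shows "(\<lambda>m. let n = Suc m in
            catalan n * (harm (2 * n) - 1 / 2 * harm n) / (4 ^ n * (2 * real n + 1))
              * (pi / 2 - real (double_fact (2 * n)) / real (double_fact (2 * n + 1))))
         sums (2 * ln 2 + 7 / 8 * zeta 3 + pi / 12 * (- 12 + pi * (- 1 + ln 8)))"
proof -
  let ?b = "\<lambda>m. cbin (Suc m)" and ?o = "\<lambda>m. odd_harm (Suc m)"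
  \<comment> \<open>The partial fraction decompositions of the two parts of the \<open>n\<close>-th term, with \<open>n = m + 1\<close>.\<close>
  define s where "s m = pi / 2 * (2 * (?b m * ?o m / (2 * real m + 3))
        - 2 * (?b m * ?o m / (2 * real m + 4)))
      - (2 * (?o m / (2 * real m + 3) ^ 2) - ?o m / ((real m + 2) * (2 * real m + 3)))" for m
  have "s sums (pi / 2 * (2 * (pi / 2 * ln 2) - 2 * 1)
      - (2 * (pi\<^sup>2 / 8 * ln 2 - 7 / 16 * zeta 3) - (2 * ln 2 - pi\<^sup>2 / 12)))"
    unfolding s_def
    by (intro sums_diff sums_mult sums_cbin_odd_harm_over_odd sums_cbin_odd_harm_over_even
        sums_odd_harm_over_odd_square sums_odd_harm_over_pair)
  also have "pi / 2 * (2 * (pi / 2 * ln 2) - 2 * 1)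
      - (2 * (pi\<^sup>2 / 8 * ln 2 - 7 / 16 * zeta 3) - (2 * ln 2 - pi\<^sup>2 / 12))
      = 2 * ln 2 + 7 / 8 * zeta 3 + pi / 12 * (- 12 + pi * (- 1 + ln 8))"
  proof -
    have "ln (8 :: real) = 3 * ln 2"
      using ln_realpow[of 2 3] by simp
    then show ?thesis
      by (simp add: field_simps power2_eq_square)
  qed
  finally have "s sums (2 * ln 2 + 7 / 8 * zeta 3 + pi / 12 * (- 12 + pi * (- 1 + ln 8)))" .
  moreover have "(let n = Suc m in
            catalan n * (harm (2 * n) - 1 / 2 * harm n) / (4 ^ n * (2 * real n + 1))
              * (pi / 2 - real (double_fact (2 * n)) / real (double_fact (2 * n + 1)))) = s m" for m
  proof -
    define n where "n = Suc m"
    define q where "q = real (double_fact (2 * n)) / real (double_fact (2 * n + 1))"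
    have n: "real n = real m + 1"
      by (simp add: n_def)
    have "catalan n * (harm (2 * n) - 1 / 2 * harm n) / (4 ^ n * (2 * real n + 1)) * (pi / 2 - q)
        = odd_harm n / ((real n + 1) * (2 * real n + 1)) * (pi / 2 * cbin n - cbin n * q)"
      by (simp add: catalan_def cbin_def odd_harm_eq_harm divide_simps) (simp add: algebra_simps)
    also have "\<dots> = odd_harm n / ((real n + 1) * (2 * real n + 1))
        * (pi / 2 * cbin n - 1 / (2 * real n + 1))"
      by (simp only: q_def cbin_eq_double_fact_ratio)
    also have "\<dots> = s m"
      unfolding s_def n_def[symmetric] n by (simp add: divide_simps) algebra
    finally show ?thesis
      by (simp only: Let_def n_def[symmetric] q_def)
  qed
  ultimately show ?thesis
    by simp
qed

end
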